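(* Let $(Y,*,\circ)$ and $(K,*,\circ)$ be left skew braces, and let $\psi_*\colon(Y,* )\to\mathrm{Aut}(K,* )$ and $\psi_\circ\colon(Y,\circ)\to\mathrm{Aut}(K,\circ)$ be group actions. The split epimorphism of digroups $(p_Y,\iota_Y)\colon(Y\times K,\ltimes_{\psi_*},\ltimes_{\psi_\circ})\rightleftarrows(Y,*,\circ)$ belongs to the category of left skew braces if and only if: 1) $\psi_{\circ y}$ is a $*$-automorphism of $K$ for all $y\in Y$; 2) $\psi_{*y}\lambda^K_k=\lambda^K_k\psi_{*y}$ for all $(y,k)\in Y\times K$; 3) $\psi_{*\,(\gamma\circ y)*\gamma^{-*}}=\psi_{\circ\gamma}\,\psi_{*y}\,\psi_{\circ\gamma}^{-1}$ for all $(\gamma,y)\in Y\times Y$.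
   Context: A digroup $(X,*,\circ)$ is a set with two group structures having the same unit $1$; morphisms are maps that are homomorphisms for both laws. $x^{-*}$ denotes the inverse for $*$, and $\lambda^X_a(b)=a^{-*}*(a\circ b)$. A left skew brace is a digroup with $a\circ(b*c)=(a\circ b)*a^{-*}*(a\circ c)$ for all $a,b,c$; left skew braces form a full subcategory of digroups. On the set $Y\times K$, the semidirect product laws are $(y,k)\ltimes_{\psi_*}(y',k')=(y*y',\,k*\psi_{*y}(k'))$ and $(y,k)\ltimes_{\psi_\circ}(y',k')=(y\circ y',\,k\circ\psi_{\circ y}(k'))$; $p_Y(y,k)=y$, $\iota_Y(y)=(y,1)$. Here $\psi_{*y}$ (resp. $\psi_{\circ y}$) is the value of $\psi_*$ (resp. $\psi_\circ$) at $y$. *)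

theory Defs
  imports "HOL-Algebra.Group" "HOL-Algebra.Bij"
begin

text \<open>Both laws of a digroup share one carrier and one unit, so a single unit field encodes the
  requirement that the two groups have the same unit.\<close>

record 'a bimagma = "'a partial_object" +
  star :: "'a \<Rightarrow> 'a \<Rightarrow> 'a"
  circ :: "'a \<Rightarrow> 'a \<Rightarrow> 'a"
  unit :: 'a

definition star_group :: "'a bimagma \<Rightarrow> 'a monoid" where
  "star_group X = \<lparr>carrier = carrier X, mult = star X, one = unit X\<rparr>"

definition circ_group :: "'a bimagma \<Rightarrow> 'a monoid" where
  "circ_group X = \<lparr>carrier = carrier X, mult = circ X, one = unit X\<rparr>"

definition star_inv :: "'a bimagma \<Rightarrow> 'a \<Rightarrow> 'a" where
  "star_inv X a = inv\<^bsub>star_group X\<^esub> a"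

definition lambda :: "'a bimagma \<Rightarrow> 'a \<Rightarrow> 'a \<Rightarrow> 'a" where
  "lambda X a b = star X (star_inv X a) (circ X a b)"

locale digroup =
  fixes X :: "'a bimagma"
  assumes group_star: "group (star_group X)"
    and group_circ: "group (circ_group X)"

locale left_skew_brace = digroup +
  assumes left_distrib:
    "\<lbrakk>a \<in> carrier X; b \<in> carrier X; c \<in> carrier X\<rbrakk> \<Longrightarrow>
      circ X a (star X b c) = star X (star X (circ X a b) (star_inv X a)) (circ X a c)"

definition digroup_hom :: "'a bimagma \<Rightarrow> 'b bimagma \<Rightarrow> ('a \<Rightarrow> 'b) set" where
  "digroup_hom X Y = hom (star_group X) (star_group Y) \<inter> hom (circ_group X) (circ_group Y)"

text \<open>A split epimorphism consists of a morphism \<open>p\<close> together with a chosen section \<open>s\<close>.\<close>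

definition digroup_split_epi ::
    "'a bimagma \<Rightarrow> 'b bimagma \<Rightarrow> ('a \<Rightarrow> 'b) \<Rightarrow> ('b \<Rightarrow> 'a) \<Rightarrow> bool" where
  "digroup_split_epi X Y p s \<longleftrightarrow>
     digroup X \<and> digroup Y \<and> p \<in> digroup_hom X Y \<and> s \<in> digroup_hom Y X \<and>
     (\<forall>y\<in>carrier Y. p (s y) = y)"

text \<open>Left skew braces form a full subcategory of digroups, so a split epimorphism of digroups
  belongs to it as soon as its two objects do.\<close>

definition skew_brace_split_epi ::
    "'a bimagma \<Rightarrow> 'b bimagma \<Rightarrow> ('a \<Rightarrow> 'b) \<Rightarrow> ('b \<Rightarrow> 'a) \<Rightarrow> bool" where
  "skew_brace_split_epi X Y p s \<longleftrightarrow>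
     digroup_split_epi X Y p s \<and> left_skew_brace X \<and> left_skew_brace Y"

definition semidirect ::
    "'y bimagma \<Rightarrow> 'k bimagma \<Rightarrow> ('y \<Rightarrow> 'k \<Rightarrow> 'k) \<Rightarrow> ('y \<Rightarrow> 'k \<Rightarrow> 'k) \<Rightarrow> ('y \<times> 'k) bimagma" where
  "semidirect Y K \<psi>s \<psi>c =
     \<lparr>carrier = carrier Y \<times> carrier K,
      star = (\<lambda>(y, k) (y', k'). (star Y y y', star K k (\<psi>s y k'))),
      circ = (\<lambda>(y, k) (y', k'). (circ Y y y', circ K k (\<psi>c y k'))),
      unit = (unit Y, unit K)\<rparr>"

lemma group_semidirect:
  fixes G :: "'y monoid" and H :: "'k monoid"
  assumes "group G" "group H" and \<phi>: "\<phi> \<in> hom G (AutoGroup H)"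
  shows "group \<lparr>carrier = carrier G \<times> carrier H,
    mult = (\<lambda>(y, k) (y', k'). (y \<otimes>\<^bsub>G\<^esub> y', k \<otimes>\<^bsub>H\<^esub> \<phi> y k')), one = (\<one>\<^bsub>G\<^esub>, \<one>\<^bsub>H\<^esub>)\<rparr>"
    and "\<And>y. y \<in> carrier G \<Longrightarrow> \<phi> y \<one>\<^bsub>H\<^esub> = \<one>\<^bsub>H\<^esub>"
proof -
  interpret G: group G by fact
  interpret H: group H by fact
  interpret A: group "AutoGroup H" by (rule H.AutoGroup)
  interpret \<phi>: group_hom G "AutoGroup H" \<phi>
    by unfold_locales (rule \<phi>)
  have aut: "\<phi> y \<in> auto H" if "y \<in> carrier G" for y
    using \<phi>.hom_closed[OF that] by (simp add: AutoGroup_def)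
  have hom: "\<phi> y \<in> hom H H" and bij: "\<phi> y \<in> Bij (carrier H)" if "y \<in> carrier G" for y
    using aut[OF that] by (auto simp: auto_def)
  have cl: "\<phi> y k \<in> carrier H" if "y \<in> carrier G" "k \<in> carrier H" for y k
    using hom that by (auto simp: hom_def)
  have mu: "\<phi> y (k \<otimes>\<^bsub>H\<^esub> k') = \<phi> y k \<otimes>\<^bsub>H\<^esub> \<phi> y k'"
    if "y \<in> carrier G" "k \<in> carrier H" "k' \<in> carrier H" for y k k'
    using hom that by (auto simp: hom_def)
  have comp: "\<phi> (y \<otimes>\<^bsub>G\<^esub> y') k = \<phi> y (\<phi> y' k)"
    if "y \<in> carrier G" "y' \<in> carrier G" "k \<in> carrier H" for y y' k
    using \<phi>.hom_mult[of y y'] that bij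
    by (simp add: AutoGroup_def BijGroup_def compose_def)
  have one: "\<phi> \<one>\<^bsub>G\<^esub> k = k" if "k \<in> carrier H" for k
    using \<phi>.hom_one that by (simp add: AutoGroup_def BijGroup_def)
  show o: "\<phi> y \<one>\<^bsub>H\<^esub> = \<one>\<^bsub>H\<^esub>" if "y \<in> carrier G" for y
    using hom[OF that] by (simp add: hom_one H.is_group)
  show "group \<lparr>carrier = carrier G \<times> carrier H,
    mult = (\<lambda>(y, k) (y', k'). (y \<otimes>\<^bsub>G\<^esub> y', k \<otimes>\<^bsub>H\<^esub> \<phi> y k')), one = (\<one>\<^bsub>G\<^esub>, \<one>\<^bsub>H\<^esub>)\<rparr>"
  proof (rule groupI, goal_cases)
    case (5 x)
    then obtain y k where x: "x = (y, k)" "y \<in> carrier G" "k \<in> carrier H" by auto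
    show ?case
      using x by (intro bexI[of _ "(inv\<^bsub>G\<^esub> y, \<phi> (inv\<^bsub>G\<^esub> y) (inv\<^bsub>H\<^esub> k))"])
        (auto simp: cl o mu[symmetric] simp del: \<phi>.hom_inv)
  qed (auto simp: cl mu comp one G.m_assoc H.m_assoc simp del: \<phi>.hom_mult \<phi>.hom_one)
qed

lemma semidirect_split_epi:
  assumes "digroup Y" "digroup K"
    and "\<psi>s \<in> hom (star_group Y) (AutoGroup (star_group K))"
    and "\<psi>c \<in> hom (circ_group Y) (AutoGroup (circ_group K))"
  shows "digroup_split_epi (semidirect Y K \<psi>s \<psi>c) Y fst (\<lambda>y. (y, unit K))"
proof -
  interpret Y: digroup Y by fact
  interpret K: digroup K by fact
  interpret Ks: group "star_group K" by (rule K.group_star)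
  interpret Kc: group "circ_group K" by (rule K.group_circ)
  note s = group_semidirect[OF Y.group_star K.group_star assms(3)]
  note c = group_semidirect[OF Y.group_circ K.group_circ assms(4)]
  have "digroup (semidirect Y K \<psi>s \<psi>c)"
    using s(1) c(1)
    by (simp add: digroup_def semidirect_def star_group_def circ_group_def)
  then show ?thesis
    using assms(1,2) s(2) c(2) Ks.one_closed Ks.r_one[OF Ks.one_closed] Kc.r_one[OF Kc.one_closed]
    by (auto simp: digroup_split_epi_def digroup_hom_def hom_def semidirect_def
        star_group_def circ_group_def)
qed

end

theory Submission
  imports Defs
begin

text \<open>On \<open>K\<close>-components, with \<open>\<delta> = (\<alpha> \<circ> \<beta>) * \<alpha>\<^sup>-\<^sup>*\<close>, left distributivity of the semidirect product is the
  single identity \<open>a \<circ> \<psi>c \<alpha> (b * \<psi>s \<beta> c) = (a \<circ> \<psi>c \<alpha> b) * \<psi>s \<delta> (\<lambda>\<^sub>a (\<psi>c \<alpha> c))\<close>. Its instances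
  \<open>\<beta> = 1, a = 1\<close>, then \<open>\<alpha> = 1, b = 1\<close>, then \<open>a = b = 1\<close> are the three conditions, and together these
  give the identity back because \<open>a \<circ> (b * c) = (a \<circ> b) * \<lambda>\<^sub>a c\<close> in \<open>K\<close>.\<close>

text \<open>The rewrites let the group lemmas speak directly of \<open>star X\<close>,
  \<open>unit X\<close> and \<open>star_inv X\<close>. The group goal is closed while
  \<open>star_group X\<close> is still folded; only then is the definition opened for the
  rewrites.\<close>

sublocale digroup \<subseteq> star: group "star_group X"
  rewrites "carrier (star_group X) = carrier X"
    and "mult (star_group X) = star X"
    and "one (star_group X) = unit X"
    and "m_inv (star_group X) = star_inv X"
  by (simp_all add: group_star) (simp_all add: star_group_def star_inv_def fun_eq_iff)

sublocale digroup \<subseteq> circ: group "circ_group X"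
  rewrites "carrier (circ_group X) = carrier X"
    and "mult (circ_group X) = circ X"
    and "one (circ_group X) = unit X"
  by (simp_all add: group_circ) (simp_all add: circ_group_def)

lemma (in digroup) lambda_closed:
  "\<lbrakk>a \<in> carrier X; b \<in> carrier X\<rbrakk> \<Longrightarrow> lambda X a b \<in> carrier X"
  by (simp add: lambda_def)

lemma (in digroup) lambda_unit_left: "b \<in> carrier X \<Longrightarrow> lambda X (unit X) b = b"
  by (simp add: lambda_def)

lemma (in digroup) star_lambda:
  "\<lbrakk>a \<in> carrier X; b \<in> carrier X\<rbrakk> \<Longrightarrow> star X a (lambda X a b) = circ X a b"
  by (simp add: lambda_def star.m_assoc[symmetric])

text \<open>Reassociating the brace law groups its last two factors \<open>star_inv X a\<close> and
  \<open>circ X a c\<close> into \<open>lambda X a c\<close>.\<close>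

lemma (in digroup) left_skew_brace_iff_lambda:
  "left_skew_brace X \<longleftrightarrow>
     (\<forall>a\<in>carrier X. \<forall>b\<in>carrier X. \<forall>c\<in>carrier X.
        circ X a (star X b c) = star X (circ X a b) (lambda X a c))"
  using digroup_axioms
  by (auto simp: left_skew_brace_def left_skew_brace_axioms_def lambda_def star.m_assoc)

lemma (in left_skew_brace) circ_star:
  "\<lbrakk>a \<in> carrier X; b \<in> carrier X; c \<in> carrier X\<rbrakk> \<Longrightarrow>
     circ X a (star X b c) = star X (circ X a b) (lambda X a c)"
  using left_skew_brace_iff_lambda left_skew_brace_axioms by blast

text \<open>Multiplication in \<open>AutoGroup H\<close> is composition restricted to
  \<open>carrier H\<close>, so the homomorphism property becomes pointwise action laws
  there.\<close>

lemma hom_AutoGroup_action: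
  assumes "group G" "group H" and \<phi>: "\<phi> \<in> hom G (AutoGroup H)"
  shows "y \<in> carrier G \<Longrightarrow> \<phi> y \<in> auto H"
    and "\<lbrakk>y \<in> carrier G; k \<in> carrier H\<rbrakk> \<Longrightarrow> \<phi> y k \<in> carrier H"
    and "\<lbrakk>y \<in> carrier G; k \<in> carrier H; k' \<in> carrier H\<rbrakk> \<Longrightarrow>
      \<phi> y (k \<otimes>\<^bsub>H\<^esub> k') = \<phi> y k \<otimes>\<^bsub>H\<^esub> \<phi> y k'"
    and "\<lbrakk>y \<in> carrier G; y' \<in> carrier G; k \<in> carrier H\<rbrakk> \<Longrightarrow>
      \<phi> (y \<otimes>\<^bsub>G\<^esub> y') k = \<phi> y (\<phi> y' k)"
    and "k \<in> carrier H \<Longrightarrow> \<phi> \<one>\<^bsub>G\<^esub> k = k"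
proof -
  interpret H: group H by fact
  interpret \<phi>: group_hom G "AutoGroup H" \<phi>
    using assms H.AutoGroup by (simp add: group_hom_def group_hom_axioms_def)
  show aut: "\<phi> y \<in> auto H" if "y \<in> carrier G" for y
    using \<phi>.hom_closed[OF that] by (simp add: AutoGroup_def)
  show "\<phi> y k \<in> carrier H" if "y \<in> carrier G" "k \<in> carrier H"
    using aut[OF that(1)] that(2) by (auto simp: auto_def hom_def)
  show "\<phi> y (k \<otimes>\<^bsub>H\<^esub> k') = \<phi> y k \<otimes>\<^bsub>H\<^esub> \<phi> y k'"
    if "y \<in> carrier G" "k \<in> carrier H" "k' \<in> carrier H"
    using aut[OF that(1)] that(2,3) by (auto simp: auto_def hom_def)
  show "\<phi> (y \<otimes>\<^bsub>G\<^esub> y') k = \<phi> y (\<phi> y' k)"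
    if "y \<in> carrier G" "y' \<in> carrier G" "k \<in> carrier H"
    using \<phi>.hom_mult[OF that(1,2)] that aut
    by (simp add: AutoGroup_def BijGroup_def compose_def auto_def)
  show "\<phi> \<one>\<^bsub>G\<^esub> k = k" if "k \<in> carrier H"
    using \<phi>.hom_one that by (simp add: AutoGroup_def BijGroup_def)
qed

locale semidirect_data = Y: digroup Y + K: digroup K
  for Y :: "'y bimagma" and K :: "'k bimagma" +
  fixes \<psi>s \<psi>c :: "'y \<Rightarrow> 'k \<Rightarrow> 'k"
  assumes star_action: "\<psi>s \<in> hom (star_group Y) (AutoGroup (star_group K))"
    and circ_action: "\<psi>c \<in> hom (circ_group Y) (AutoGroup (circ_group K))"
begin

text \<open>The entries are, in order: closure, multiplicativity in the second argument, splitting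
  of the action of a product into a composite, and the trivial action of the unit.\<close>

lemmas star_act [simp] =
  hom_AutoGroup_action(2-)[OF Y.group_star K.group_star star_action,
    unfolded star_group_def partial_object.simps monoid.simps]

lemmas circ_act [simp] =
  hom_AutoGroup_action(2-)[OF Y.group_circ K.group_circ circ_action,
    unfolded circ_group_def partial_object.simps monoid.simps]

lemma act_unit [simp]:
  assumes "y \<in> carrier Y"
  shows "\<psi>s y (unit K) = unit K" "\<psi>c y (unit K) = unit K"
  using group_semidirect(2)[OF Y.group_star K.group_star star_action]
    group_semidirect(2)[OF Y.group_circ K.group_circ circ_action] assms
  by (simp_all add: star_group_def circ_group_def)

lemma circ_act_bij:
  assumes "y \<in> carrier Y"
  shows "\<psi>c y \<in> Bij (carrier K)" "bij_betw (\<psi>c y) (carrier K) (carrier K)"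
  using hom_AutoGroup_action(1)[OF Y.group_circ K.group_circ circ_action, of y] assms
  by (simp_all add: circ_group_def auto_def Bij_def)

sublocale P: digroup "semidirect Y K \<psi>s \<psi>c"
  using semidirect_split_epi[OF Y.digroup_axioms K.digroup_axioms star_action circ_action]
  by (simp add: digroup_split_epi_def)

lemma star_inv_semidirect:
  assumes "y \<in> carrier Y" "k \<in> carrier K"
  shows "star_inv (semidirect Y K \<psi>s \<psi>c) (y, k) =
    (star_inv Y y, \<psi>s (star_inv Y y) (star_inv K k))"
proof (rule P.star.inv_equality)
  show "star (semidirect Y K \<psi>s \<psi>c) (star_inv Y y, \<psi>s (star_inv Y y) (star_inv K k)) (y, k) =
      unit (semidirect Y K \<psi>s \<psi>c)"
    \<comment> \<open>Multiplicativity is used from right to left, so that the two images under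
      \<open>\<psi>s (star_inv Y y)\<close> merge into the image of
      \<open>star K (star_inv K k) k\<close>, which is the unit.\<close>
    using assms star_act(2)[of "star_inv Y y" "star_inv K k" k, symmetric]
    by (simp add: semidirect_def del: star_act(2))
qed (use assms in \<open>simp_all add: semidirect_def\<close>)

text \<open>This is the right side of the brace law in the product. The \<open>lambda\<close> of the
  product carries a twist by \<open>\<psi>s (star_inv Y \<alpha>)\<close>; multiplying by an element
  over \<open>circ Y \<alpha> \<beta>\<close> composes it with
  \<open>\<psi>s (circ Y \<alpha> \<beta>)\<close>, which yields the action of \<delta>.\<close>

lemma star_circ_lambda_semidirect:
  assumes "\<alpha> \<in> carrier Y" "\<beta> \<in> carrier Y" "\<gamma> \<in> carrier Y"
    and "a \<in> carrier K" "b \<in> carrier K" "c \<in> carrier K"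
  shows "star (semidirect Y K \<psi>s \<psi>c) (circ (semidirect Y K \<psi>s \<psi>c) (\<alpha>, a) (\<beta>, b))
      (lambda (semidirect Y K \<psi>s \<psi>c) (\<alpha>, a) (\<gamma>, c)) =
    (star Y (circ Y \<alpha> \<beta>) (lambda Y \<alpha> \<gamma>),
     star K (circ K a (\<psi>c \<alpha> b))
       (\<psi>s (star Y (circ Y \<alpha> \<beta>) (star_inv Y \<alpha>)) (lambda K a (\<psi>c \<alpha> c))))"
proof -
  have "lambda (semidirect Y K \<psi>s \<psi>c) (\<alpha>, a) (\<gamma>, c) =
      (lambda Y \<alpha> \<gamma>, \<psi>s (star_inv Y \<alpha>) (lambda K a (\<psi>c \<alpha> c)))"
    using assms unfolding lambda_def[of "semidirect Y K \<psi>s \<psi>c"]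
    by (simp add: star_inv_semidirect) (simp add: semidirect_def lambda_def)
  then show ?thesis
    using assms by (simp add: semidirect_def K.lambda_closed)
qed

text \<open>The first components agree by the brace law of \<open>Y\<close>, so only the
  \<open>K\<close>-components impose a condition.\<close>

lemma left_skew_brace_semidirect_iff:
  assumes "left_skew_brace Y"
  shows "left_skew_brace (semidirect Y K \<psi>s \<psi>c) \<longleftrightarrow>
    (\<forall>\<alpha>\<in>carrier Y. \<forall>\<beta>\<in>carrier Y. \<forall>a\<in>carrier K. \<forall>b\<in>carrier K. \<forall>c\<in>carrier K.
       circ K a (\<psi>c \<alpha> (star K b (\<psi>s \<beta> c))) =
       star K (circ K a (\<psi>c \<alpha> b))
         (\<psi>s (star Y (circ Y \<alpha> \<beta>) (star_inv Y \<alpha>)) (lambda K a (\<psi>c \<alpha> c))))"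
    (is "?L \<longleftrightarrow> ?R")
proof -
  let ?P = "semidirect Y K \<psi>s \<psi>c"
  have carrier: "carrier ?P = carrier Y \<times> carrier K"
    by (simp add: semidirect_def)
  have lhs: "circ ?P (\<alpha>, a) (star ?P (\<beta>, b) (\<gamma>, c)) =
      (circ Y \<alpha> (star Y \<beta> \<gamma>), circ K a (\<psi>c \<alpha> (star K b (\<psi>s \<beta> c))))" for \<alpha> \<beta> \<gamma> a b c
    by (simp add: semidirect_def)
  have distrib: "circ Y \<alpha> (star Y \<beta> \<gamma>) = star Y (circ Y \<alpha> \<beta>) (lambda Y \<alpha> \<gamma>)"
    if "\<alpha> \<in> carrier Y" "\<beta> \<in> carrier Y" "\<gamma> \<in> carrier Y" for \<alpha> \<beta> \<gamma>
    using left_skew_brace.circ_star[OF assms that] .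
  show ?thesis
    unfolding P.left_skew_brace_iff_lambda
  proof
    assume L: "\<forall>a\<in>carrier ?P. \<forall>b\<in>carrier ?P. \<forall>c\<in>carrier ?P.
      circ ?P a (star ?P b c) = star ?P (circ ?P a b) (lambda ?P a c)"
    show ?R
    proof (intro ballI)
      fix \<alpha> \<beta> a b c
      assume m: "\<alpha> \<in> carrier Y" "\<beta> \<in> carrier Y" "a \<in> carrier K" "b \<in> carrier K" "c \<in> carrier K"
      \<comment> \<open>The \<open>K\<close>-component does not involve the third
        \<open>Y\<close>-entry, so any value serves; \<open>unit Y\<close> is chosen.\<close>
      have "circ ?P (\<alpha>, a) (star ?P (\<beta>, b) (unit Y, c)) =
          star ?P (circ ?P (\<alpha>, a) (\<beta>, b)) (lambda ?P (\<alpha>, a) (unit Y, c))"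
        using L m by (simp add: carrier)
      then show "circ K a (\<psi>c \<alpha> (star K b (\<psi>s \<beta> c))) =
          star K (circ K a (\<psi>c \<alpha> b))
            (\<psi>s (star Y (circ Y \<alpha> \<beta>) (star_inv Y \<alpha>)) (lambda K a (\<psi>c \<alpha> c)))"
        unfolding lhs using m by (subst (asm) star_circ_lambda_semidirect) auto
    qed
  next
    assume R: ?R
    show "\<forall>a\<in>carrier ?P. \<forall>b\<in>carrier ?P. \<forall>c\<in>carrier ?P.
      circ ?P a (star ?P b c) = star ?P (circ ?P a b) (lambda ?P a c)"
      unfolding carrier
    proof (clarify)
      fix \<alpha> a \<beta> b \<gamma> c
      assume "\<alpha> \<in> carrier Y" "\<beta> \<in> carrier Y" "\<gamma> \<in> carrier Y"
        "a \<in> carrier K" "b \<in> carrier K" "c \<in> carrier K"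
      then show "circ ?P (\<alpha>, a) (star ?P (\<beta>, b) (\<gamma>, c)) =
          star ?P (circ ?P (\<alpha>, a) (\<beta>, b)) (lambda ?P (\<alpha>, a) (\<gamma>, c))"
        using R by (simp only: lhs star_circ_lambda_semidirect distrib prod.inject simp_thms)
    qed
  qed
qed

text \<open>Both group laws live on one carrier, so membership in \<open>Bij\<close> carries over
  and only multiplicativity for \<open>star\<close> remains.\<close>

lemma circ_act_auto_star_iff:
  assumes "y \<in> carrier Y"
  shows "\<psi>c y \<in> auto (star_group K) \<longleftrightarrow>
    (\<forall>a\<in>carrier K. \<forall>b\<in>carrier K. \<psi>c y (star K a b) = star K (\<psi>c y a) (\<psi>c y b))"
  using assms circ_act_bij(1)[OF assms]
  by (auto simp: auto_def hom_def star_group_def)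

text \<open>Since \<open>\<psi>c \<gamma>\<close> permutes \<open>carrier K\<close>, replacing
  \<open>x\<close> by \<open>\<psi>c \<gamma> x\<close> removes the inverse from the
  conjugation.\<close>

lemma conjugation_iff:
  assumes "\<gamma> \<in> carrier Y" "y \<in> carrier Y" "z \<in> carrier Y"
  shows "(\<forall>x\<in>carrier K. \<psi>s z x = \<psi>c \<gamma> (\<psi>s y (inv_into (carrier K) (\<psi>c \<gamma>) x))) \<longleftrightarrow>
    (\<forall>x\<in>carrier K. \<psi>s z (\<psi>c \<gamma> x) = \<psi>c \<gamma> (\<psi>s y x))"
proof -
  let ?Q = "\<lambda>x. \<psi>s z x = \<psi>c \<gamma> (\<psi>s y (inv_into (carrier K) (\<psi>c \<gamma>) x))"
  note bij = circ_act_bij(2)[OF assms(1)]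
  have "(\<forall>x\<in>carrier K. ?Q x) \<longleftrightarrow> (\<forall>x\<in>\<psi>c \<gamma> ` carrier K. ?Q x)"
    by (simp only: bij_betw_imp_surj_on[OF bij])
  also have "\<dots> \<longleftrightarrow> (\<forall>x\<in>carrier K. \<psi>s z (\<psi>c \<gamma> x) = \<psi>c \<gamma> (\<psi>s y x))"
    by (simp add: bij_betw_inv_into_left[OF bij])
  finally show ?thesis .
qed

end

theorem theorem3p5:
  fixes Y :: "'y bimagma" and K :: "'k bimagma"
    and \<psi>s \<psi>c :: "'y \<Rightarrow> 'k \<Rightarrow> 'k"
  assumes "left_skew_brace Y" and "left_skew_brace K"
    and "\<psi>s \<in> hom (star_group Y) (AutoGroup (star_group K))"
    and "\<psi>c \<in> hom (circ_group Y) (AutoGroup (circ_group K))"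
  shows "skew_brace_split_epi (semidirect Y K \<psi>s \<psi>c) Y fst (\<lambda>y. (y, unit K)) \<longleftrightarrow>
    (\<forall>y\<in>carrier Y. \<psi>c y \<in> auto (star_group K)) \<and>
    (\<forall>y\<in>carrier Y. \<forall>k\<in>carrier K. \<forall>x\<in>carrier K.
       \<psi>s y (lambda K k x) = lambda K k (\<psi>s y x)) \<and>
    (\<forall>\<gamma>\<in>carrier Y. \<forall>y\<in>carrier Y. \<forall>x\<in>carrier K.
       \<psi>s (star Y (circ Y \<gamma> y) (star_inv Y \<gamma>)) x =
       \<psi>c \<gamma> (\<psi>s y (inv_into (carrier K) (\<psi>c \<gamma>) x)))"
proof -
  interpret Y: left_skew_brace Y by fact
  interpret K: left_skew_brace K by fact
  interpret semidirect_data Y K \<psi>s \<psi>c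
    using assms(3,4) by unfold_locales
  let ?\<delta> = "\<lambda>\<alpha> \<beta>. star Y (circ Y \<alpha> \<beta>) (star_inv Y \<alpha>)"
  let ?E = "\<forall>\<alpha>\<in>carrier Y. \<forall>\<beta>\<in>carrier Y. \<forall>a\<in>carrier K. \<forall>b\<in>carrier K. \<forall>c\<in>carrier K.
    circ K a (\<psi>c \<alpha> (star K b (\<psi>s \<beta> c))) =
    star K (circ K a (\<psi>c \<alpha> b)) (\<psi>s (?\<delta> \<alpha> \<beta>) (lambda K a (\<psi>c \<alpha> c)))"
  let ?A = "\<forall>y\<in>carrier Y. \<forall>a\<in>carrier K. \<forall>b\<in>carrier K.
    \<psi>c y (star K a b) = star K (\<psi>c y a) (\<psi>c y b)"
  let ?B = "\<forall>y\<in>carrier Y. \<forall>k\<in>carrier K. \<forall>x\<in>carrier K.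
    \<psi>s y (lambda K k x) = lambda K k (\<psi>s y x)"
  let ?C = "\<forall>\<gamma>\<in>carrier Y. \<forall>y\<in>carrier Y. \<forall>x\<in>carrier K.
    \<psi>s (?\<delta> \<gamma> y) (\<psi>c \<gamma> x) = \<psi>c \<gamma> (\<psi>s y x)"
  have "?E \<longleftrightarrow> ?A \<and> ?B \<and> ?C"
  proof (intro iffI conjI ballI)
    fix y a b assume E: ?E and m: "y \<in> carrier Y" "a \<in> carrier K" "b \<in> carrier K"
    \<comment> \<open>Here \<open>?\<delta> y (unit Y)\<close> collapses to \<open>unit Y\<close>,
      which acts trivially.\<close>
    show "\<psi>c y (star K a b) = star K (\<psi>c y a) (\<psi>c y b)"
      using E[rule_format, of y "unit Y" "unit K" a b] m
      by (simp add: K.lambda_unit_left del: star_act(3))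
  next
    fix y k x assume E: ?E and m: "y \<in> carrier Y" "k \<in> carrier K" "x \<in> carrier K"
    \<comment> \<open>With \<open>unit Y\<close> in the first place, \<open>?\<delta>\<close>
      returns \<open>y\<close> and \<open>\<psi>c\<close> acts trivially; the common left factor
      \<open>k\<close> is cancelled afterwards.\<close>
    have "circ K k (\<psi>s y x) = star K k (\<psi>s y (lambda K k x))"
      using E[rule_format, of "unit Y" y k "unit K" x] m
      by (simp add: K.lambda_closed del: star_act(3))
    then have "star K k (lambda K k (\<psi>s y x)) = star K k (\<psi>s y (lambda K k x))"
      using m by (simp add: K.star_lambda)
    then show "\<psi>s y (lambda K k x) = lambda K k (\<psi>s y x)"
      using m by (simp add: K.lambda_closed)
  next
    fix \<gamma> y x assume E: ?E and m: "\<gamma> \<in> carrier Y" "y \<in> carrier Y" "x \<in> carrier K"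
    show "\<psi>s (?\<delta> \<gamma> y) (\<psi>c \<gamma> x) = \<psi>c \<gamma> (\<psi>s y x)"
      using E[rule_format, of \<gamma> y "unit K" "unit K" x] m
      by (simp add: K.lambda_unit_left del: star_act(3))
  next
    fix \<alpha> \<beta> a b c assume ABC: "?A \<and> ?B \<and> ?C"
      and m: "\<alpha> \<in> carrier Y" "\<beta> \<in> carrier Y" "a \<in> carrier K" "b \<in> carrier K" "c \<in> carrier K"
    \<comment> \<open>\<open>?A\<close> splits \<open>\<psi>c \<alpha>\<close> over
      \<open>star\<close>, and the brace law of \<open>K\<close> then distributes
      \<open>circ K a\<close>.\<close>
    have "circ K a (\<psi>c \<alpha> (star K b (\<psi>s \<beta> c))) =
        star K (circ K a (\<psi>c \<alpha> b)) (lambda K a (\<psi>c \<alpha> (\<psi>s \<beta> c)))"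
      using ABC m by (simp add: K.circ_star)
    \<comment> \<open>\<open>?C\<close> moves \<open>\<psi>c \<alpha>\<close> inside, and
      \<open>?B\<close> then pulls the star action out of \<open>lambda K a\<close>. Disabling
      \<open>star_act(3)\<close> keeps the action of \<open>?\<delta> \<alpha> \<beta>\<close> in
      one piece.\<close>
    also have "lambda K a (\<psi>c \<alpha> (\<psi>s \<beta> c)) = lambda K a (\<psi>s (?\<delta> \<alpha> \<beta>) (\<psi>c \<alpha> c))"
      using ABC m by (simp del: star_act(3))
    also have "\<dots> = \<psi>s (?\<delta> \<alpha> \<beta>) (lambda K a (\<psi>c \<alpha> c))"
      using ABC m by (simp del: star_act(3))
    finally show "circ K a (\<psi>c \<alpha> (star K b (\<psi>s \<beta> c))) =
        star K (circ K a (\<psi>c \<alpha> b)) (\<psi>s (?\<delta> \<alpha> \<beta>) (lambda K a (\<psi>c \<alpha> c)))" .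
  qed
  \<comment> \<open>The digroup split epimorphism always exists and \<open>Y\<close> is a brace, so
    only the brace law of the product is at stake.\<close>
  moreover have "skew_brace_split_epi (semidirect Y K \<psi>s \<psi>c) Y fst (\<lambda>y. (y, unit K)) \<longleftrightarrow> ?E"
    using semidirect_split_epi[OF Y.digroup_axioms K.digroup_axioms assms(3,4)] assms(1)
    by (simp only: skew_brace_split_epi_def left_skew_brace_semidirect_iff simp_thms)
  ultimately show ?thesis
    by (simp add: circ_act_auto_star_iff conjugation_iff del: star_act(3))
qed

end
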